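(* Let $a,b\in C^1(\mathbb{R})$ be $1$-periodic functions with $a>0$ and $0<b<1$ on $\mathbb{R}$, and set $$d_0=\sqrt{2\int_0^1a(s)\,ds}\left(\frac12-\frac{\int_0^1a(s)b(s)\,ds}{\int_0^1a(s)\,ds}\right),\qquad d_*=\int_0^1\sqrt{2a(s)}\left(\frac12-b(s)\right)ds .$$ For $T>0$ let $d_T$ be the unique speed of the time periodic traveling wave connecting $0$ and $1$ for $v_t=v_{xx}+a(t/T)v(v-b(t/T))(1-v)$, $t,x\in\mathbb{R}$. Then: (i) If $a=a_0$ is a positive constant, then $d_T=d_0=d_*$ for all $T>0$. (ii) If $b=b_0\in(0,1)$ is a constant, then $d_0\ge d_*>0$ when $0<b_0<1/2$, and $d_0\le d_*<0$ when $1/2<b_0<1$; moreover, the inequalities between $d_0$ and $d_*$ are strict as soon as $a(\cdot)$ is not constant. (iii) There exist $1$-periodic functions $a\in C^1(\mathbb{R},(0,\infty))$ and $b\in C^1(\mathbb{R},(0,1))$ such that $d_0$ and $d_*$ have different (opposite) signs.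
   Context: Let $a,b\in C^1(\mathbb{R})$ be $1$-periodic functions with $a>0$ and $0<b<1$ on $\mathbb{R}$, and let $T>0$. A time periodic traveling wave connecting $0$ and $1$ for the equation $v_t=v_{xx}+a(t/T)\,v\,\big(v-b(t/T)\big)(1-v)$, $t\in\mathbb{R}$, $x\in\mathbb{R}$, is a solution of the form $v_T(t,x)=V_T(t,x-d_Tt)$, $t,x\in\mathbb{R}$, with $d_T\in\mathbb{R}$ a constant, $V_T(t,x)$ $T$-periodic in $t$, and $V_T(t,-\infty)=1$, $V_T(t,+\infty)=0$ uniformly in $t$. It is known that for each $T>0$ such a wave exists, is unique up to spatial shifts (in particular $d_T$ is unique), and $V_T$ is decreasing in $x$. *)

theory Defs
  imports "HOL-Analysis.Analysis" "HOL-Library.Periodic_Fun"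
begin

definition admissible :: "(real \<Rightarrow> real) \<Rightarrow> (real \<Rightarrow> real) \<Rightarrow> bool" where
  "admissible a b \<longleftrightarrow>
     a C1_differentiable_on UNIV \<and> b C1_differentiable_on UNIV \<and>
     periodic_fun_simple a 1 \<and> periodic_fun_simple b 1 \<and>
     (\<forall>s. 0 < a s) \<and> (\<forall>s. 0 < b s \<and> b s < 1)"

text \<open>Classical entire solutions: \<open>p\<close>, \<open>q\<close>, \<open>r\<close> are the derivatives
  \<open>v\<^sub>t\<close>, \<open>v\<^sub>x\<close>, \<open>v\<^sub>x\<^sub>x\<close>, required to exist everywhere and to be jointly
  continuous in \<open>(t, x)\<close>.\<close>

definition bistable_solution ::
  "(real \<Rightarrow> real) \<Rightarrow> (real \<Rightarrow> real) \<Rightarrow> real \<Rightarrow> (real \<Rightarrow> real \<Rightarrow> real) \<Rightarrow> bool" where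
  "bistable_solution a b T v \<longleftrightarrow>
     (\<exists>p q r :: real \<Rightarrow> real \<Rightarrow> real.
        (\<forall>t x. ((\<lambda>s. v s x) has_real_derivative p t x) (at t)) \<and>
        (\<forall>t x. ((\<lambda>y. v t y) has_real_derivative q t x) (at x)) \<and>
        (\<forall>t x. ((\<lambda>y. q t y) has_real_derivative r t x) (at x)) \<and>
        continuous_on UNIV (\<lambda>(t, x). p t x) \<and>
        continuous_on UNIV (\<lambda>(t, x). q t x) \<and>
        continuous_on UNIV (\<lambda>(t, x). r t x) \<and>
        (\<forall>t x. p t x = r t x + a (t / T) * v t x * (v t x - b (t / T)) * (1 - v t x)))"

definition periodic_travelling_wave ::
  "(real \<Rightarrow> real) \<Rightarrow> (real \<Rightarrow> real) \<Rightarrow> real \<Rightarrow> real \<Rightarrow> (real \<Rightarrow> real \<Rightarrow> real) \<Rightarrow> bool" where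
  "periodic_travelling_wave a b T d V \<longleftrightarrow>
     bistable_solution a b T (\<lambda>t x. V t (x - d * t)) \<and>
     periodic_fun_simple V T \<and>
     uniform_limit UNIV (\<lambda>x t. V t x) (\<lambda>t. 1) at_bot \<and>
     uniform_limit UNIV (\<lambda>x t. V t x) (\<lambda>t. 0) at_top"

definition is_wave_speed :: "(real \<Rightarrow> real) \<Rightarrow> (real \<Rightarrow> real) \<Rightarrow> real \<Rightarrow> real \<Rightarrow> bool" where
  "is_wave_speed a b T d \<longleftrightarrow> (\<exists>V. periodic_travelling_wave a b T d V)"

definition wave_speed :: "(real \<Rightarrow> real) \<Rightarrow> (real \<Rightarrow> real) \<Rightarrow> real \<Rightarrow> real" where
  "wave_speed a b T = (THE d. is_wave_speed a b T d)"

definition speed0 :: "(real \<Rightarrow> real) \<Rightarrow> (real \<Rightarrow> real) \<Rightarrow> real" where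
  "speed0 a b =
     sqrt (2 * integral {0..1} a) *
     (1 / 2 - integral {0..1} (\<lambda>s. a s * b s) / integral {0..1} a)"

definition speed_star :: "(real \<Rightarrow> real) \<Rightarrow> (real \<Rightarrow> real) \<Rightarrow> real" where
  "speed_star a b = integral {0..1} (\<lambda>s. sqrt (2 * a s) * (1 / 2 - b s))"

end

(* For constant a = 2 k^2 the fronts v(t, x) = 1 / (1 + exp (k (x - c(t)))) with
   c'(t) = k (1 - 2 b(t/T)) are exact solutions, because the logistic profile is the same for
   every threshold b; averaging c' over a period gives the speed. For uniqueness, periodicity and
   the uniform limits let a wave attain any maximum above 1, which the equation forbids. If a
   wave moved faster than the explicit front, compare it with that front sped up by a small
   epsilon and lifted by a small constant q: this is a strict supersolution, so a first contact
   point is impossible, yet the faster wave would eventually overtake it. The reflection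
   v(t, x) -> 1 - v(t, -x), b -> 1 - b gives the opposite inequality.
   For constant b, the two speeds compare by the strict Cauchy-Schwarz inequality for sqrt (2 a),
   and trigonometric polynomials provide speeds of opposite sign. *)

theory Submission
  imports Defs
begin

section \<open>Periodic functions and joint continuity\<close>

lemma periodic_shift_int:
  fixes f :: "real \<Rightarrow> 'a"
  assumes "\<And>x. f (x + T) = f x"
  shows "f (x + of_int n * T) = f x"
proof -
  interpret periodic_fun_simple f T
    by unfold_locales (rule assms)
  show ?thesis by (rule plus_of_int)
qed

lemma periodic_representative:
  fixes x T :: real
  assumes "T > 0"
  obtains n :: int where "x + of_int n * T \<in> {0..T}"
proof
  have "of_int \<lfloor>x / T\<rfloor> * T \<le> x" "x \<le> (of_int \<lfloor>x / T\<rfloor> + 1) * T"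
    using assms by (simp_all flip: pos_le_divide_eq pos_divide_le_eq)
  then show "x + of_int (- \<lfloor>x / T\<rfloor>) * T \<in> {0..T}"
    by (simp add: distrib_right)
qed

lemma periodic_continuous_bounded:
  fixes f :: "real \<Rightarrow> real"
  assumes "T > 0" "\<And>x. f (x + T) = f x" "continuous_on UNIV f"
  obtains K where "K > 0" "\<And>x. \<bar>f x\<bar> \<le> K"
proof -
  have "compact (f ` {0..T})"
    using assms(3) by (intro compact_continuous_image continuous_on_subset[OF assms(3)]) auto
  then obtain K where K: "K > 0" "\<And>x. x \<in> {0..T} \<Longrightarrow> \<bar>f x\<bar> \<le> K"
    by (metis bounded_pos compact_imp_bounded imageI real_norm_def)
  have "\<bar>f x\<bar> \<le> K" for x
    using periodic_representative[OF assms(1), of x] periodic_shift_int[of f T x, OF assms(2)] K(2)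
    by metis
  with K(1) show thesis using that by blast
qed

lemma integrable_on_unit_interval:
  fixes f :: "real \<Rightarrow> real"
  assumes "continuous_on UNIV f"
  shows "f integrable_on {0..1}"
  using assms by (intro integrable_continuous_real) (auto intro: continuous_on_subset)

lemma admissible_facts:
  assumes "admissible a b"
  shows "continuous_on UNIV a" "continuous_on UNIV b"
    "\<And>s. a (s + 1) = a s" "\<And>s. b (s + 1) = b s"
    "\<And>s. 0 < a s" "\<And>s. 0 < b s" "\<And>s. b s < 1"
  using assms
  by (auto simp: admissible_def periodic_fun_simple_def intro: C1_differentiable_imp_continuous_on)

text \<open>Solutions come with joint continuity of their derivatives, but the compactness arguments
  need it for the solution itself. One jointly continuous partial derivative and mere existence of
  the other give total differentiability.\<close>

lemma continuous_on_of_partials: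
  fixes v p q :: "real \<Rightarrow> real \<Rightarrow> real"
  assumes p: "\<And>t x. ((\<lambda>s. v s x) has_real_derivative p t x) (at t)"
    and q: "\<And>t x. ((\<lambda>y. v t y) has_real_derivative q t x) (at x)"
    and cont: "continuous_on UNIV (\<lambda>(t, x). q t x)"
  shows "continuous_on UNIV (\<lambda>(t, x). v t x)"
proof -
  have "((\<lambda>(t, x). v t x) has_derivative (\<lambda>(s, y). p t x * s + blinfun_scaleR_left (q t x) y))
          (at (t, x) within UNIV \<times> UNIV)" for t x
  proof (rule has_derivative_partialsI)
    show "((\<lambda>s. v s x) has_derivative (*) (p t x)) (at t)"
      using p by (simp add: has_field_derivative_def)
    show "((\<lambda>y. v t y) has_derivative blinfun_apply (blinfun_scaleR_left (q t x))) (at x)" for t x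
      using q[of t x] by (simp add: has_field_derivative_def mult_commute_abs)
    have "continuous_on UNIV (\<lambda>z. blinfun_scaleR_left (case z of (t, x) \<Rightarrow> q t x) :: real \<Rightarrow>\<^sub>L real)"
      by (intro bounded_linear.continuous_on[OF bounded_linear_blinfun_scaleR_left] cont)
    then show "continuous (at (t, x) within UNIV \<times> UNIV) (\<lambda>(t, x). blinfun_scaleR_left (q t x) :: real \<Rightarrow>\<^sub>L real)"
      by (simp add: continuous_on_eq_continuous_within split_beta')
  qed auto
  then have "((\<lambda>(t, x). v t x) has_derivative (\<lambda>(s, y). p t x * s + blinfun_scaleR_left (q t x) y))
          (at (t, x))" for t x
    by simp
  then show ?thesis
    by (auto simp: continuous_on_eq_continuous_within intro: has_derivative_continuous)
qed

section \<open>Parabolic maximum principle\<close>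

text \<open>If \<open>l\<close> were positive, \<open>f'\<close> would be positive just to the right
  of its zero \<open>x\<close>, and \<open>f\<close> would rise above its maximum.\<close>

lemma second_derivative_at_max:
  fixes f f' :: "real \<Rightarrow> real"
  assumes f: "\<And>y. (f has_real_derivative f' y) (at y)"
    and f': "(f' has_real_derivative l) (at x)"
    and max: "\<And>y. f y \<le> f x"
  shows "l \<le> 0"
proof (rule ccontr)
  assume "\<not> l \<le> 0"
  then obtain d where d: "d > 0" "\<And>h. \<lbrakk>0 < h; h < d\<rbrakk> \<Longrightarrow> f' x < f' (x + h)"
    using has_real_derivative_pos_inc_right[OF f'] by auto
  have "f' x = 0"
    using DERIV_local_max[OF f, of 1] max by simp
  then have pos: "f' y > 0" if "x < y" "y < x + d" for y
    using d(2)[of "y - x"] that by simp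
  have "f x < f (x + d / 2)"
  proof (rule DERIV_pos_imp_increasing_open[of _ _ f])
    show "continuous_on {x..x + d / 2} f"
      using f by (meson DERIV_atLeastAtMost_imp_continuous_on)
  qed (use d(1) in \<open>auto intro!: exI f pos\<close>)
  with max show False by (simp add: not_le[symmetric])
qed

text \<open>First-contact argument: up to the first time at which \<open>u\<close> reaches 0 it is
  negative, so at the contact point \<open>ut\<close> is nonnegative and \<open>uxx\<close> is
  nonpositive, against \<open>touch\<close>. The differential inequality is thus demanded only where
  \<open>u\<close> vanishes, and \<open>far\<close> confines contacts to a compact set.\<close>

lemma parabolic_maximum_principle:
  fixes u :: "real \<Rightarrow> real \<Rightarrow> real"
  assumes ut: "\<And>t x. ((\<lambda>s. u s x) has_real_derivative ut t x) (at t)"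
    and ux: "\<And>t x. ((\<lambda>y. u t y) has_real_derivative ux t x) (at x)"
    and uxx: "\<And>t x. ((\<lambda>y. ux t y) has_real_derivative uxx t x) (at x)"
    and cont: "continuous_on UNIV (\<lambda>(t, x). u t x)"
    and initial: "\<And>x. u 0 x < 0"
    and far: "\<And>t x. \<lbrakk>0 \<le> t; t \<le> S; \<bar>x\<bar> > R\<rbrakk> \<Longrightarrow> u t x < 0"
    and touch: "\<And>t x. u t x = 0 \<Longrightarrow> ut t x < uxx t x"
    and t: "0 \<le> t" "t \<le> S"
  shows "u t x < 0"
proof (rule ccontr)
  assume neg: "\<not> u t x < 0"
  \<comment> \<open>Compactness of the set of violations provides one with the earliest
    time.\<close>
  define A where "A = {z \<in> {0..S} \<times> {-R..R}. u (fst z) (snd z) \<ge> 0}"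
  have "closed {z. u (fst z) (snd z) \<ge> 0}"
    using cont by (intro closed_Collect_le) (auto simp: split_beta')
  then have "compact (({0..S} \<times> {-R..R}) \<inter> {z. u (fst z) (snd z) \<ge> 0})"
    by (intro compact_Int_closed compact_Times) auto
  moreover have "A = ({0..S} \<times> {-R..R}) \<inter> {z. u (fst z) (snd z) \<ge> 0}"
    by (auto simp: A_def)
  ultimately have "compact A" by simp
  moreover have "\<bar>x\<bar> \<le> R"
    using neg t far by (meson not_le)
  then have "(t, x) \<in> A"
    using neg t by (auto simp: A_def)
  moreover have "continuous_on A fst" by (intro continuous_intros)
  ultimately obtain z where z: "z \<in> A" "\<And>y. y \<in> A \<Longrightarrow> fst z \<le> fst y"
    using continuous_attains_inf[of A fst] by blast
  obtain t0 x0 where [simp]: "z = (t0, x0)" by (cases z)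
  have z0: "0 \<le> t0" "t0 \<le> S" "u t0 x0 \<ge> 0"
    using z(1) by (auto simp: A_def)
  have "t0 > 0"
    using z0 initial[of x0] by (cases "t0 = 0") auto
  have before: "u s y < 0" if "0 \<le> s" "s < t0" for s y
  proof (rule ccontr)
    assume "\<not> u s y < 0"
    moreover from this have "\<bar>y\<bar> \<le> R"
      using that z0 far[of s y] by (meson not_le less_imp_le order_trans)
    ultimately have "(s, y) \<in> A"
      using that z0 by (auto simp: A_def)
    then show False using z(2) that by fastforce
  qed
  \<comment> \<open>Continuity in time carries the negativity before \<open>t0\<close> over to
    \<open>t0\<close>, so \<open>x0\<close> is a spatial maximum with value 0.\<close>
  have le: "u t0 y \<le> 0" for y
  proof (rule ccontr)
    assume "\<not> u t0 y \<le> 0"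
    moreover have "isCont (\<lambda>s. u s y) t0"
      using ut DERIV_isCont by blast
    ultimately have "eventually (\<lambda>s. u s y > 0) (at t0)"
      by (intro order_tendstoD) (auto simp: isCont_def)
    then obtain d where d: "d > 0" "\<And>s. \<lbrakk>s \<noteq> t0; dist s t0 < d\<rbrakk> \<Longrightarrow> u s y > 0"
      by (auto simp: eventually_at)
    \<comment> \<open>The minimum with \<open>t0\<close> keeps \<open>s\<close> nonnegative, so that
      \<open>before\<close> applies.\<close>
    define s where "s = t0 - min (d / 2) t0"
    have "0 \<le> s" "s < t0" "dist s t0 < d"
      using d(1) \<open>t0 > 0\<close> by (auto simp: s_def dist_real_def)
    then show False using before[of s y] d(2)[of s] by simp
  qed
  have zero: "u t0 x0 = 0" using le[of x0] z0 by simp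
  have "uxx t0 x0 \<le> 0"
    using second_derivative_at_max[OF ux uxx] le zero by simp
  moreover have "ut t0 x0 \<ge> 0"
  proof (rule ccontr)
    assume "\<not> ut t0 x0 \<ge> 0"
    then obtain d where d: "d > 0" "\<And>h. \<lbrakk>0 < h; h < d\<rbrakk> \<Longrightarrow> u t0 x0 < u (t0 - h) x0"
      using has_real_derivative_neg_dec_left[OF ut, of t0 x0] by auto
    define h where "h = min (d / 2) t0"
    have "u t0 x0 < u (t0 - h) x0" "u (t0 - h) x0 < 0"
      using d \<open>t0 > 0\<close> by (auto simp: h_def intro!: d(2) before)
    then show False using zero by simp
  qed
  ultimately show False using touch[OF zero] by simp
qed

section \<open>Bounds for arbitrary waves\<close>

lemma wave_limits:
  assumes "periodic_travelling_wave a b T d V" "e > 0"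
  obtains R where "\<And>t x. x \<le> -R \<Longrightarrow> \<bar>V t x - 1\<bar> < e" "\<And>t x. x \<ge> R \<Longrightarrow> \<bar>V t x\<bar> < e"
proof -
  have "eventually (\<lambda>x. \<forall>t. \<bar>V t x - 1\<bar> < e) at_bot" "eventually (\<lambda>x. \<forall>t. \<bar>V t x\<bar> < e) at_top"
    using assms unfolding periodic_travelling_wave_def uniform_limit_iff dist_real_def by auto
  then obtain R1 R2 where
    R: "\<And>x t. x \<le> R1 \<Longrightarrow> \<bar>V t x - 1\<bar> < e" "\<And>x t. x \<ge> R2 \<Longrightarrow> \<bar>V t x\<bar> < e"
    unfolding eventually_at_bot_linorder eventually_at_top_linorder by blast
  show thesis
    by (rule that[of "max (-R1) R2"]) (use R in auto)
qed

text \<open>This bound lets a front lifted by \<open>q\<close> dominate the wave wherever the front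
  exceeds \<open>1 - q\<close>. At an attained maximum above 1 the time derivative vanishes and
  diffusion is nonpositive, while the reaction is strictly negative.\<close>

lemma wave_le_one:
  assumes ab: "\<And>s. a s > 0" "\<And>s. b s < 1" and T: "T > 0"
    and wave: "periodic_travelling_wave a b T d V"
  shows "V t x \<le> 1"
proof (rule ccontr)
  assume "\<not> V t x \<le> 1"
  then have gt: "V t x > 1" by simp
  \<comment> \<open>A level strictly between 1 and the offending value: both tails stay below it, so
    the maximum over a compact box is global.\<close>
  define M where "M = (V t x + 1) / 2"
  have M: "1 < M" "M < V t x" using gt by (auto simp: M_def)
  have sol: "bistable_solution a b T (\<lambda>t x. V t (x - d * t))"
    and per: "periodic_fun_simple V T"
    using wave by (auto simp: periodic_travelling_wave_def)
  define v where "v = (\<lambda>t x. V t (x - d * t))"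
  obtain p q r where
    p: "\<And>t x. ((\<lambda>s. v s x) has_real_derivative p t x) (at t)" and
    q: "\<And>t x. ((\<lambda>y. v t y) has_real_derivative q t x) (at x)" and
    r: "\<And>t x. ((\<lambda>y. q t y) has_real_derivative r t x) (at x)" and
    cq: "continuous_on UNIV (\<lambda>(t, x). q t x)" and
    eq: "\<And>t x. p t x = r t x + a (t / T) * v t x * (v t x - b (t / T)) * (1 - v t x)"
    using sol unfolding bistable_solution_def v_def by blast
  have cv: "continuous_on UNIV (\<lambda>(t, x). v t x)"
    by (rule continuous_on_of_partials[OF p q cq])
  obtain R where
    R: "\<And>t x. x \<le> -R \<Longrightarrow> \<bar>V t x - 1\<bar> < M - 1" "\<And>t x. x \<ge> R \<Longrightarrow> \<bar>V t x\<bar> < M - 1"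
    using wave_limits[OF wave, of "M - 1"] M by auto
  have small: "V t x < M" if "x \<notin> {-R..R}" for t x
    using R[of x t] that M by (cases "x \<le> -R") auto
  define L where "L = {0..T} \<times> {-R..R}"
  have reduce: "\<exists>s\<in>{0..T}. V s = V t" for t
    using periodic_representative[OF T, of t] periodic_shift_int[of V T t] per
    unfolding periodic_fun_simple_def by metis
  obtain s where s: "s \<in> {0..T}" "V s = V t" using reduce by blast
  have "(s, x) \<in> L"
    using s M small[of x t] by (auto simp: L_def)
  moreover have "compact L" unfolding L_def by (intro compact_Times) auto
  moreover have "continuous_on L (\<lambda>z. V (fst z) (snd z))"
  proof -
    have "continuous_on L (\<lambda>z. (\<lambda>(t, x). v t x) (fst z, snd z + d * fst z))"
      by (rule continuous_on_compose2[OF cv]) (auto intro!: continuous_intros)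
    then show ?thesis by (simp add: v_def)
  qed
  ultimately obtain z where z: "z \<in> L" "\<And>y. y \<in> L \<Longrightarrow> V (fst y) (snd y) \<le> V (fst z) (snd z)"
    using continuous_attains_sup[of L "\<lambda>z. V (fst z) (snd z)"] by blast
  obtain t0 y0 where [simp]: "z = (t0, y0)" by (cases z)
  have big: "V t0 y0 > M"
    using z(2)[OF \<open>(s, x) \<in> L\<close>] s M by simp
  have top: "V t y \<le> V t0 y0" for t y
  proof (cases "y \<in> {-R..R}")
    case True
    obtain s where "s \<in> {0..T}" "V s = V t" using reduce by blast
    with True z(2)[of "(s, y)"] show ?thesis by (auto simp: L_def)
  next
    case False
    then show ?thesis using small[of y t] big by simp
  qed
  \<comment> \<open>Returning to the fixed frame only shifts space at each time, which preserves the
    global maximum; hence the time derivative of \<open>v\<close> itself vanishes there.\<close>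
  define x0 where "x0 = y0 + d * t0"
  have vtop: "v t x \<le> v t0 x0" for t x
    using top by (simp add: v_def x0_def)
  have v1: "v t0 x0 > 1" using big M by (simp add: v_def x0_def)
  have "r t0 x0 \<le> 0"
    using second_derivative_at_max[OF q r] vtop by blast
  moreover have "p t0 x0 = 0"
    using DERIV_local_max[OF p, of 1 t0 x0] vtop by simp
  moreover have "a (t0 / T) * v t0 x0 * (v t0 x0 - b (t0 / T)) * (1 - v t0 x0) < 0"
    using v1 ab(1)[of "t0 / T"] ab(2)[of "t0 / T"]
    by (intro mult_pos_neg mult_pos_pos) auto
  ultimately show False using eq[of t0 x0] by simp
qed

section \<open>Logistic fronts\<close>

text \<open>The exponent carries no minus sign, so the profile decreases from 1 to 0 as the waves
  do; it solves \<open>y' = - y * (1 - y)\<close>.\<close>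

definition logistic :: "real \<Rightarrow> real" where
  "logistic z = 1 / (1 + exp z)"

lemma logistic_pos: "logistic z > 0" and logistic_less_one: "logistic z < 1"
  by (auto simp: logistic_def field_simps add_pos_pos)

lemma logistic_minus: "logistic (- z) = 1 - logistic z"
proof -
  have "1 + exp z \<noteq> 0" "1 + exp (- z) \<noteq> 0"
    using exp_gt_zero[of z] exp_gt_zero[of "- z"] by linarith+
  then show ?thesis
    by (simp add: logistic_def field_simps exp_minus)
qed

text \<open>The exponential tail near 0; combined with \<open>logistic_minus\<close> it also
  controls the approach to 1.\<close>

lemma logistic_less:
  assumes "e > 0" "z \<ge> - ln e"
  shows "logistic z < e"
proof -
  have "1 = e * exp (- ln e)" using assms by (simp add: exp_minus)
  also have "\<dots> \<le> e * exp z" using assms by simp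
  also have "\<dots> < e * (1 + exp z)" using assms by simp
  finally show ?thesis
    by (simp add: logistic_def divide_less_eq add_pos_pos)
qed

lemma has_real_derivative_logistic:
  "(logistic has_real_derivative - (logistic z * (1 - logistic z))) (at z)"
proof -
  have "1 + exp z \<noteq> 0" using exp_gt_zero[of z] by linarith
  then show ?thesis
    unfolding logistic_def [abs_def]
    by (auto intro!: derivative_eq_intros simp: field_simps power2_eq_square)
qed

lemma continuous_on_logistic: "continuous_on A logistic"
  using has_real_derivative_logistic
  by (meson DERIV_continuous continuous_at_imp_continuous_on)

text \<open>Every derivative is a polynomial in the value \<open>F\<close>, the one in time with the
  extra factor \<open>c'\<close>. Checking the equation for a front of any motion \<open>c\<close>
  thus reduces to algebra.\<close>

lemma logistic_front_derivatives:
  fixes c c' :: "real \<Rightarrow> real" and k :: real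
  assumes c: "\<And>t. (c has_real_derivative c' t) (at t)"
  defines "F \<equiv> \<lambda>t x. logistic (k * (x - c t))"
  shows "((\<lambda>s. F s x) has_real_derivative k * c' t * (F t x * (1 - F t x))) (at t)"
    and "((\<lambda>y. F t y) has_real_derivative - (k * (F t x * (1 - F t x)))) (at x)"
    and "((\<lambda>y. - (k * (F t y * (1 - F t y)))) has_real_derivative
           k\<^sup>2 * (F t x * (1 - F t x)) * (1 - 2 * F t x)) (at x)"
proof -
  note D = DERIV_chain2[OF has_real_derivative_logistic]
  show "((\<lambda>s. F s x) has_real_derivative k * c' t * (F t x * (1 - F t x))) (at t)"
  proof -
    have "((\<lambda>s. k * (x - c s)) has_real_derivative - (k * c' t)) (at t)"
      by (auto intro!: derivative_eq_intros c)
    from D[OF this] show ?thesis by (simp add: F_def algebra_simps)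
  qed
  show x: "((\<lambda>y. F t y) has_real_derivative - (k * (F t x * (1 - F t x)))) (at x)" for x
  proof -
    have "((\<lambda>y. k * (y - c t)) has_real_derivative k) (at x)"
      by (auto intro!: derivative_eq_intros)
    from D[OF this] show ?thesis by (simp add: F_def algebra_simps)
  qed
  show "((\<lambda>y. - (k * (F t y * (1 - F t y)))) has_real_derivative
           k\<^sup>2 * (F t x * (1 - F t x)) * (1 - 2 * F t x)) (at x)"
    by (auto intro!: derivative_eq_intros x simp: algebra_simps power2_eq_square)
qed

lemma continuous_on_logistic_front:
  fixes c :: "real \<Rightarrow> real"
  assumes "continuous_on UNIV c"
  shows "continuous_on UNIV (\<lambda>(t, x). logistic (k * (x - c t)))"
proof -
  have "continuous_on UNIV (\<lambda>z :: real \<times> real. c (fst z))"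
    by (rule continuous_on_compose2[OF assms continuous_on_fst[OF continuous_on_id]]) auto
  then show ?thesis
    unfolding split_beta'
    by (intro continuous_on_compose2[OF continuous_on_logistic[of UNIV]] continuous_intros) auto
qed

section \<open>Explicit waves for constant \<open>a\<close>\<close>

text \<open>An antiderivative of \<open>b\<close> grows by the mean of \<open>b\<close> over each
  period. So \<open>c\<close> minus its linear drift is continuous and \<open>T\<close>-periodic,
  hence bounded; the bound \<open>K\<close> later makes the limits of the wave uniform in
  time.\<close>

lemma front_position_exists:
  fixes b :: "real \<Rightarrow> real"
  assumes b: "continuous_on UNIV b" "\<And>s. b (s + 1) = b s" and T: "T > 0"
  obtains c K where
    "\<And>t. (c has_real_derivative k * (1 - 2 * b (t / T))) (at t)"
    "\<And>t. c (t + T) = c t + k * (1 - 2 * integral {0..1} b) * T"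
    "\<And>t. \<bar>c t - k * (1 - 2 * integral {0..1} b) * t\<bar> \<le> K"
proof -
  obtain G where G: "\<And>s. (G has_vector_derivative b s) (at s)"
    using einterval_antiderivative[of "-\<infinity>" \<infinity> b] b(1)
    by (auto simp: continuous_on_eq_continuous_at)
  then have dG: "(G has_real_derivative b s) (at s)" for s
    by (simp add: has_real_derivative_iff_has_vector_derivative)
  have int: "integral {0..1} b = G 1 - G 0"
    using fundamental_theorem_of_calculus[of 0 1 G b] G
    by (intro integral_unique) (auto intro: has_vector_derivative_at_within)
  have "((\<lambda>s. G (s + 1) - G s) has_real_derivative 0) (at s)" for s
  proof -
    have "((\<lambda>s. G (s + 1)) has_real_derivative b (s + 1)) (at s)"
      using dG DERIV_shift[of G "b (s + 1)" s 1] by blast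
    then show ?thesis
      using DERIV_diff[OF _ dG[of s]] b(2)[of s] by fastforce
  qed
  then have G1: "G (s + 1) = G s + integral {0..1} b" for s
    using DERIV_isconst_all[of "\<lambda>s. G (s + 1) - G s" s 0] int by simp
  define D where "D = k * (1 - 2 * integral {0..1} b)"
  \<comment> \<open>The factor \<open>T\<close> cancels the \<open>1 / T\<close> from
    differentiating \<open>G (t / T)\<close>.\<close>
  define c where "c = (\<lambda>t. k * (t - 2 * T * G (t / T)))"
  have dc: "(c has_real_derivative k * (1 - 2 * b (t / T))) (at t)" for t
    unfolding c_def using T
    by (auto intro!: derivative_eq_intros DERIV_chain2[OF dG] simp: field_simps)
  have per: "c (t + T) = c t + D * T" for t
    using G1[of "t / T"] T by (simp add: c_def D_def add_divide_distrib algebra_simps)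
  have "continuous_on UNIV (\<lambda>t. c t - D * t)"
    using dc by (intro continuous_intros) (auto intro!: DERIV_continuous_on)
  moreover have "c (t + T) - D * (t + T) = c t - D * t" for t
    using per[of t] by (simp add: algebra_simps)
  ultimately obtain K where "\<And>t. \<bar>c t - D * t\<bar> \<le> K"
    using periodic_continuous_bounded[OF T, of "\<lambda>t. c t - D * t"] by metis
  with dc per show thesis
    using that[of c K] by (simp add: D_def)
qed

text \<open>Writing the constant as \<open>2 * k\<^sup>2\<close> turns \<open>sqrt (2 * a)\<close>
  into \<open>2 * k\<close>, where \<open>k\<close> is the steepness of the logistic front.\<close>

lemma speed_star_const:
  assumes "admissible (\<lambda>_. 2 * k\<^sup>2) b" "k > 0"
  shows "speed_star (\<lambda>_. 2 * k\<^sup>2) b = k * (1 - 2 * integral {0..1} b)"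
    and "speed0 (\<lambda>_. 2 * k\<^sup>2) b = k * (1 - 2 * integral {0..1} b)"
proof -
  have sq: "sqrt (4 * k\<^sup>2) = 2 * k"
    using assms(2) by (simp add: real_sqrt_mult)
  have "b integrable_on {0..1}"
    by (rule integrable_on_unit_interval[OF admissible_facts(2)[OF assms(1)]])
  then have "integral {0..1} (\<lambda>s. 1 / 2 - b s) = 1 / 2 - integral {0..1} b"
    by (subst integral_diff) auto
  then show "speed_star (\<lambda>_. 2 * k\<^sup>2) b = k * (1 - 2 * integral {0..1} b)"
    using sq by (simp add: speed_star_def)
  show "speed0 (\<lambda>_. 2 * k\<^sup>2) b = k * (1 - 2 * integral {0..1} b)"
    using sq assms(2) by (simp add: speed0_def field_simps)
qed

text \<open>The front position oscillates around a line of slope \<open>D\<close>. Seen in the frame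
  of speed \<open>D\<close> the front becomes a wave, whose periodicity is that of
  \<open>c t - D * t\<close>.\<close>

lemma wave_speed_exists:
  assumes adm: "admissible (\<lambda>_. 2 * k\<^sup>2) b" and k: "k > 0" and T: "T > 0"
  shows "is_wave_speed (\<lambda>_. 2 * k\<^sup>2) b T (k * (1 - 2 * integral {0..1} b))"
proof -
  note b = admissible_facts[OF adm]
  define D where "D = k * (1 - 2 * integral {0..1} b)"
  obtain c K where c: "\<And>t. (c has_real_derivative k * (1 - 2 * b (t / T))) (at t)"
    "\<And>t. c (t + T) = c t + D * T" "\<And>t. \<bar>c t - D * t\<bar> \<le> K"
    using front_position_exists[OF b(2,4) T, of k] unfolding D_def by metis
  define F where "F = (\<lambda>t x. logistic (k * (x - c t)))"
  define V where "V = (\<lambda>t x. F t (x + D * t))"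
  have cc: "continuous_on UNIV c"
    using c(1) by (auto intro!: DERIV_continuous_on)
  have cF: "continuous_on UNIV (\<lambda>z. F (fst z) (snd z))"
    using continuous_on_logistic_front[OF cc, of k] by (simp add: F_def split_beta')
  have cb: "continuous_on UNIV (\<lambda>z. b (fst z / T))"
    using T by (intro continuous_on_compose2[OF b(2)] continuous_intros) auto
  note dF = logistic_front_derivatives[OF c(1), where k = k]
  have "bistable_solution (\<lambda>_. 2 * k\<^sup>2) b T F"
    unfolding bistable_solution_def
  proof (intro exI conjI allI)
    show "continuous_on UNIV (\<lambda>(t, x). k * (k * (1 - 2 * b (t / T))) * (F t x * (1 - F t x)))"
      "continuous_on UNIV (\<lambda>(t, x). - (k * (F t x * (1 - F t x))))"
      "continuous_on UNIV (\<lambda>(t, x). k\<^sup>2 * (F t x * (1 - F t x)) * (1 - 2 * F t x))"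
      unfolding split_beta' by (intro continuous_intros cF cb)+
    show "((\<lambda>s. F s x) has_real_derivative k * (k * (1 - 2 * b (t / T))) * (F t x * (1 - F t x))) (at t)" for t x
      unfolding F_def by (rule dF)
    show "((\<lambda>y. F t y) has_real_derivative - (k * (F t x * (1 - F t x)))) (at x)" for t x
      unfolding F_def by (rule dF)
    show "((\<lambda>y. - (k * (F t y * (1 - F t y)))) has_real_derivative
           k\<^sup>2 * (F t x * (1 - F t x)) * (1 - 2 * F t x)) (at x)" for t x
      unfolding F_def by (rule dF)
    \<comment> \<open>Here \<open>2 * (F - b) = (2 * F - 1) + (1 - 2 * b)\<close>: the first part
      cancels the diffusion, the second is the motion of the front.\<close>
    show "k * (k * (1 - 2 * b (t / T))) * (F t x * (1 - F t x)) =
        k\<^sup>2 * (F t x * (1 - F t x)) * (1 - 2 * F t x) +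
        2 * k\<^sup>2 * F t x * (F t x - b (t / T)) * (1 - F t x)" for t x
      by (simp add: algebra_simps power2_eq_square)
  qed
  then have "bistable_solution (\<lambda>_. 2 * k\<^sup>2) b T (\<lambda>t x. V t (x - D * t))"
    by (simp add: V_def)
  moreover have "periodic_fun_simple V T"
    by unfold_locales (simp add: V_def F_def c(2) algebra_simps)
  moreover have "uniform_limit UNIV (\<lambda>x t. V t x) (\<lambda>t. 0) at_top"
    unfolding uniform_limit_iff
  proof (intro allI impI)
    fix e :: real assume e: "e > 0"
    \<comment> \<open>\<open>K\<close> absorbs the oscillation of the front and
      \<open>- ln e / k\<close> the tail of the profile.\<close>
    have "\<bar>V t x\<bar> < e" if "x \<ge> K - ln e / k" for t x
    proof -
      have "- ln e \<le> k * (x - K)"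
        using that k by (simp add: field_simps)
      also have "\<dots> \<le> k * (x + D * t - c t)"
        using c(3)[of t] k by (intro mult_left_mono) linarith+
      finally show ?thesis
        using logistic_less[OF e] logistic_pos[of "k * (x + D * t - c t)"]
        by (simp add: V_def F_def)
    qed
    then show "\<forall>\<^sub>F x in at_top. \<forall>t\<in>UNIV. dist (V t x) 0 < e"
      unfolding eventually_at_top_linorder by auto
  qed
  moreover have "uniform_limit UNIV (\<lambda>x t. V t x) (\<lambda>t. 1) at_bot"
    unfolding uniform_limit_iff
  proof (intro allI impI)
    fix e :: real assume e: "e > 0"
    have "dist (V t x) 1 < e" if "x \<le> - (K - ln e / k)" for t x
    proof -
      have "- ln e \<le> k * (- x - K)"
        using that k by (simp add: field_simps)
      also have "\<dots> \<le> k * (- (x + D * t - c t))"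
        using c(3)[of t] k by (intro mult_left_mono) linarith+
      finally have "logistic (- (k * (x + D * t - c t))) < e"
        using logistic_less[OF e] by (simp only: mult_minus_right)
      then show ?thesis
        using logistic_less_one[of "k * (x + D * t - c t)"]
        by (simp add: V_def F_def logistic_minus dist_real_def)
    qed
    then show "\<forall>\<^sub>F x in at_bot. \<forall>t\<in>UNIV. dist (V t x) 1 < e"
      unfolding eventually_at_bot_linorder by auto
  qed
  ultimately show ?thesis
    unfolding is_wave_speed_def periodic_travelling_wave_def D_def by blast
qed

section \<open>Uniqueness of the speed\<close>

text \<open>The shift \<open>q\<close> pushes the profile above the stable states, where the reaction pulls
  back at rate \<open>m\<close>; in the transition zone, where it may not pull back, the extra speed \<open>\<epsilon>\<close>
  of the front pays for the shift.\<close>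

lemma cubic_shift_less:
  fixes u q b m A \<delta> :: real
  assumes "0 < u" "u < 1" "0 < q" "2 * q < m" "m \<le> b" "m \<le> 1 - b" "A > 0" "3 * A * q \<le> \<delta>"
  shows "A * (u + q) * (u + q - b) * (1 - (u + q)) < \<delta> * (u * (1 - u)) + A * u * (u - b) * (1 - u)"
proof -
  \<comment> \<open>The first two terms of the bracket are the derivative of the cubic at
    \<open>u\<close>; the last collects the higher orders in \<open>q\<close>. The weighted mean of
    \<open>b\<close> and \<open>1 - b\<close> is at least \<open>m\<close>, which beats the higher
    orders because \<open>2 * q < m\<close>.\<close>
  have "(u + q) * (u + q - b) * (1 - (u + q)) - u * (u - b) * (1 - u)
      = q * (3 * (u * (1 - u)) - (b * (1 - u) + (1 - b) * u) + q * (1 + b - 3 * u - q))"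
    by (simp add: algebra_simps)
  also have "\<dots> < q * (3 * (u * (1 - u)))"
  proof -
    have "m = m * (1 - u) + m * u" by (simp add: algebra_simps)
    also have "\<dots> \<le> b * (1 - u) + (1 - b) * u"
      using assms by (intro add_mono mult_right_mono) auto
    finally have "m \<le> b * (1 - u) + (1 - b) * u" .
    moreover have "q * (1 + b - 3 * u - q) \<le> q * 2"
      using assms by (intro mult_left_mono) auto
    ultimately have "3 * (u * (1 - u)) - (b * (1 - u) + (1 - b) * u) + q * (1 + b - 3 * u - q)
        < 3 * (u * (1 - u))"
      using assms(4) by linarith
    then show ?thesis
      using assms(3) by (rule mult_strict_left_mono)
  qed
  finally have "A * ((u + q) * (u + q - b) * (1 - (u + q)) - u * (u - b) * (1 - u))
      < A * (q * (3 * (u * (1 - u))))"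
    using assms by (intro mult_strict_left_mono)
  also have "\<dots> = 3 * A * q * (u * (1 - u))" by simp
  also have "\<dots> \<le> \<delta> * (u * (1 - u))"
    using assms by (intro mult_right_mono) auto
  finally show ?thesis by (simp add: algebra_simps)
qed

text \<open>If \<open>d = D + 2 * \<epsilon>\<close>, a front of average speed
  \<open>D + \<epsilon>\<close> is fast enough to be a strict supersolution after lifting by
  \<open>q\<close>, yet slower than the wave. The maximum principle keeps the wave below it forever,
  while the speeds force an overtaking.\<close>

lemma wave_speed_upper_bound:
  assumes adm: "admissible (\<lambda>_. 2 * k\<^sup>2) b" and k: "k > 0" and T: "T > 0"
    and speed: "is_wave_speed (\<lambda>_. 2 * k\<^sup>2) b T d"
  shows "d \<le> k * (1 - 2 * integral {0..1} b)"
proof (rule ccontr)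
  define D where "D = k * (1 - 2 * integral {0..1} b)"
  assume "\<not> d \<le> k * (1 - 2 * integral {0..1} b)"
  then have dD: "d > D" by (simp add: D_def)
  define \<epsilon> where "\<epsilon> = (d - D) / 2"
  have eps: "\<epsilon> > 0" using dD by (simp add: \<epsilon>_def)
  note b = admissible_facts[OF adm]
  obtain V where wave: "periodic_travelling_wave (\<lambda>_. 2 * k\<^sup>2) b T d V"
    using speed by (auto simp: is_wave_speed_def)
  \<comment> \<open>The reciprocal of \<open>b * (1 - b)\<close> is continuous and periodic, hence
    bounded. Both factors are below 1, so a lower bound for the product serves each of them.\<close>
  obtain m where m: "m > 0" "\<And>s. m \<le> b s" "\<And>s. m \<le> 1 - b s"
  proof -
    have pos: "b s * (1 - b s) > 0" for s using b(6,7)[of s] by simp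
    have "continuous_on UNIV (\<lambda>s. 1 / (b s * (1 - b s)))"
      using less_imp_neq[OF pos, symmetric] by (intro continuous_intros b(2)) blast
    then obtain K where K: "K > 0" "\<And>s. \<bar>1 / (b s * (1 - b s))\<bar> \<le> K"
      using periodic_continuous_bounded[of 1 "\<lambda>s. 1 / (b s * (1 - b s))"] b(4) by auto
    have lower: "1 / K \<le> b s * (1 - b s)" for s
      using K(2)[of s] K(1) pos[of s] by (simp add: field_simps)
    have "b s * (1 - b s) \<le> b s" "(1 - b s) * b s \<le> 1 - b s" for s
      using b(6,7)[of s] by (intro mult_left_le; simp)+
    then have "1 / K \<le> b s" "1 / K \<le> 1 - b s" for s
      using lower[of s] by (metis mult.commute order_trans)+
    with K(1) that[of "1 / K"] show thesis by simp
  qed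
  \<comment> \<open>The three bounds give, in order, \<open>2 * q < m\<close>, the final
    contradiction between 3/4 and 1/2 + 1/4, and the cost condition of
    \<open>cubic_shift_less\<close> with \<open>A = 2 * k\<^sup>2\<close> and
    \<open>\<delta> = k * \<epsilon>\<close>.\<close>
  define q where "q = min (m / 4) (min (1 / 4) (\<epsilon> / (6 * k)))"
  have q: "0 < q" "2 * q < m" "q \<le> 1 / 4" "3 * (2 * k\<^sup>2) * q \<le> k * \<epsilon>"
  proof -
    have "\<epsilon> / (6 * k) > 0" using eps k by simp
    then show "0 < q" "2 * q < m" "q \<le> 1 / 4"
      using m(1) unfolding q_def by linarith+
    have "q \<le> \<epsilon> / (6 * k)" by (simp add: q_def)
    then have "6 * k * q \<le> \<epsilon>"
      using k by (simp add: pos_le_divide_eq mult.commute)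
    then have "k * (6 * k * q) \<le> k * \<epsilon>"
      using k by (intro mult_left_mono) auto
    then show "3 * (2 * k\<^sup>2) * q \<le> k * \<epsilon>"
      by (simp add: power2_eq_square mult_ac)
  qed
  obtain c K where c: "\<And>t. (c has_real_derivative k * (1 - 2 * b (t / T))) (at t)"
    "\<And>t. \<bar>c t - D * t\<bar> \<le> K"
    using front_position_exists[OF b(2,4) T, of k] unfolding D_def by metis
  obtain R where R: "\<And>t x. x \<le> -R \<Longrightarrow> \<bar>V t x - 1\<bar> < q" "\<And>t x. x \<ge> R \<Longrightarrow> \<bar>V t x\<bar> < q"
    using wave_limits[OF wave q(1)] by metis
  define v where "v = (\<lambda>t x. V t (x - d * t))"
  have v1: "v t x \<le> 1" for t x
    unfolding v_def using wave_le_one[OF _ b(7) T wave] k by simp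
  obtain vt vx vxx where
    vt: "\<And>t x. ((\<lambda>s. v s x) has_real_derivative vt t x) (at t)" and
    vx: "\<And>t x. ((\<lambda>y. v t y) has_real_derivative vx t x) (at x)" and
    vxx: "\<And>t x. ((\<lambda>y. vx t y) has_real_derivative vxx t x) (at x)" and
    cvx: "continuous_on UNIV (\<lambda>(t, x). vx t x)" and
    veq: "\<And>t x. vt t x = vxx t x + 2 * k\<^sup>2 * v t x * (v t x - b (t / T)) * (1 - v t x)"
    using wave unfolding periodic_travelling_wave_def bistable_solution_def v_def by blast
  have cv: "continuous_on UNIV (\<lambda>(t, x). v t x)"
    by (rule continuous_on_of_partials[OF vt vx cvx])
  \<comment> \<open>\<open>L\<close> is the distance behind the front from which on it exceeds
    \<open>1 - q\<close>. The head start \<open>h\<close> covers the transition zones and the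
    oscillation of \<open>c\<close>, so the comparison holds at time 0.\<close>
  define L where "L = - ln q / k"
  define h where "h = \<bar>R\<bar> + \<bar>L\<bar> + \<bar>K\<bar>"
  define C where "C = (\<lambda>t. c t + \<epsilon> * t + h)"
  have dC: "(C has_real_derivative (k * (1 - 2 * b (t / T)) + \<epsilon>)) (at t)" for t
    unfolding C_def by (auto intro!: derivative_eq_intros c(1))
  define F where "F = (\<lambda>t x. logistic (k * (x - C t)))"
  note dF = logistic_front_derivatives[OF dC, where k = k]
  have dFt: "((\<lambda>s. F s x) has_real_derivative
      k * (k * (1 - 2 * b (t / T)) + \<epsilon>) * (F t x * (1 - F t x))) (at t)"
    and dFx: "((\<lambda>y. F t y) has_real_derivative - (k * (F t x * (1 - F t x)))) (at x)"
    and dFxx: "((\<lambda>y. - (k * (F t y * (1 - F t y)))) has_real_derivative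
           k\<^sup>2 * (F t x * (1 - F t x)) * (1 - 2 * F t x)) (at x)" for t x
    unfolding F_def by (rule dF)+
  have cC: "continuous_on UNIV C"
    using dC by (auto intro!: DERIV_continuous_on)
  have cF: "continuous_on UNIV (\<lambda>(t, x). F t x)"
    unfolding F_def by (rule continuous_on_logistic_front[OF cC])
  have F01: "0 < F t x" "F t x < 1" for t x
    by (simp_all add: F_def logistic_pos logistic_less_one)
  have behind: "1 - q < F t x" if "x \<le> C t - L" for t x
  proof -
    have "- ln q \<le> k * (C t - x)"
      using that k by (simp add: L_def field_simps)
    then have "logistic (- (k * (x - C t))) < q"
      using logistic_less[OF q(1), of "k * (C t - x)"] by (simp add: algebra_simps)
    then show ?thesis by (simp add: F_def logistic_minus)
  qed
  have ahead: "v t x < F t x + q" if "x - d * t \<ge> R" for t x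
    using R(2)[OF that, of t] F01(1)[of t x] by (simp add: v_def)
  have below_behind: "v t x < F t x + q" if "x \<le> C t - L" for t x
    using behind[OF that] v1[of t x] by linarith
  have initial: "v 0 x < F 0 x + q" for x
  proof (cases "x \<ge> R")
    case False
    moreover have "\<bar>c 0\<bar> \<le> K" "C 0 = c 0 + h"
      using c(2)[of 0] by (simp_all add: C_def)
    ultimately have "x \<le> C 0 - L"
      unfolding h_def by linarith
    then show ?thesis by (rule below_behind)
  qed (simp add: ahead)
  \<comment> \<open>Up to time \<open>t\<close> wave and front drift at most linearly, so a point
    outside this radius is either ahead of the wave or well behind the front.\<close>
  have far: "v s x < F s x + q"
    if s: "0 \<le> s" "s \<le> t" and x: "\<bar>x\<bar> > \<bar>R\<bar> + \<bar>d\<bar> * t + \<bar>D\<bar> * t + \<bar>K\<bar> + \<bar>L\<bar>" for s t x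
  proof (cases "x > 0")
    case True
    have "d * s \<le> \<bar>d\<bar> * t"
      using s by (intro mult_mono) auto
    moreover have "0 \<le> \<bar>D\<bar> * t" using s by simp
    ultimately have "x - d * s \<ge> R"
      using True x by linarith
    then show ?thesis by (rule ahead)
  next
    case False
    have "- (D * s) \<le> \<bar>D\<bar> * t"
      using s mult_mono[of "- D" "\<bar>D\<bar>" s t] by simp
    moreover have "0 \<le> \<bar>d\<bar> * t" "0 \<le> \<epsilon> * s" using s eps by simp_all
    moreover have "c s \<ge> D * s - K" using c(2)[of s] by (simp add: abs_le_iff)
    ultimately have "x \<le> C s - L"
      using False x unfolding C_def h_def by linarith
    then show ?thesis by (rule below_behind)
  qed
  \<comment> \<open>At a contact the reaction of the wave is evaluated at \<open>F + q\<close>, and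
    the extra speed of the front outweighs its change.\<close>
  have touch: "vt t x - k * (k * (1 - 2 * b (t / T)) + \<epsilon>) * (F t x * (1 - F t x))
      < vxx t x - k\<^sup>2 * (F t x * (1 - F t x)) * (1 - 2 * F t x)"
    if eq: "v t x = F t x + q" for t x
  proof -
    have "2 * k\<^sup>2 * v t x * (v t x - b (t / T)) * (1 - v t x)
        < k * \<epsilon> * (F t x * (1 - F t x)) + 2 * k\<^sup>2 * F t x * (F t x - b (t / T)) * (1 - F t x)"
      unfolding eq using k by (intro cubic_shift_less[where m = m] F01 q m) auto
    also have "\<dots> = k * (k * (1 - 2 * b (t / T)) + \<epsilon>) * (F t x * (1 - F t x))
        - k\<^sup>2 * (F t x * (1 - F t x)) * (1 - 2 * F t x)"
      by (simp add: algebra_simps power2_eq_square)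
    finally show ?thesis using veq[of t x] by simp
  qed
  have less: "v t x < F t x + q" if t: "t \<ge> 0" for t x
  proof -
    define u where "u = (\<lambda>t x. v t x - (F t x + q))"
    have ut: "((\<lambda>s. u s x) has_real_derivative
        vt t x - (k * (k * (1 - 2 * b (t / T)) + \<epsilon>) * (F t x * (1 - F t x)) + 0)) (at t)" for t x
      unfolding u_def by (intro DERIV_diff DERIV_add vt dFt DERIV_const)
    have ux: "((\<lambda>y. u t y) has_real_derivative
        vx t x - (- (k * (F t x * (1 - F t x))) + 0)) (at x)" for t x
      unfolding u_def by (intro DERIV_diff DERIV_add vx dFx DERIV_const)
    have uxx: "((\<lambda>y. vx t y - (- (k * (F t y * (1 - F t y))) + 0)) has_real_derivative
        vxx t x - (k\<^sup>2 * (F t x * (1 - F t x)) * (1 - 2 * F t x) + 0)) (at x)" for t x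
      by (intro DERIV_diff DERIV_add vxx dFxx DERIV_const)
    have cu: "continuous_on UNIV (\<lambda>(t, x). u t x)"
      using cv cF unfolding u_def split_beta' by (intro continuous_intros)
    have "u t x < 0"
    proof (rule parabolic_maximum_principle[OF ut ux uxx cu _ _ _ t order_refl])
      show "u 0 x < 0" for x
        using initial[of x] by (simp add: u_def)
      show "u s x < 0"
        if "0 \<le> s" "s \<le> t" "\<bar>R\<bar> + \<bar>d\<bar> * t + \<bar>D\<bar> * t + \<bar>K\<bar> + \<bar>L\<bar> < \<bar>x\<bar>" for s x
        using far[OF that] by (simp add: u_def)
      show "vt t x - (k * (k * (1 - 2 * b (t / T)) + \<epsilon>) * (F t x * (1 - F t x)) + 0)
          < vxx t x - (k\<^sup>2 * (F t x * (1 - F t x)) * (1 - 2 * F t x) + 0)"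
        if "u t x = 0" for t x
        using touch[of t x] that by (simp add: u_def)
    qed
    then show ?thesis by (simp add: u_def)
  qed
  \<comment> \<open>By time \<open>S\<close> the wave has gained \<open>\<epsilon> * S\<close> on
    the front, which makes up for \<open>R\<close>, the oscillation and the head start. The point
    \<open>x\<close> chosen next lies at the back of the wave, where \<open>V\<close> is near 1, but
    not behind the midpoint of the front.\<close>
  define S where "S = (\<bar>R\<bar> + \<bar>K\<bar> + h) / \<epsilon>"
  have "S \<ge> 0" using eps by (simp add: S_def h_def)
  define x where "x = d * S - R"
  have "v S x > 3 / 4"
    using R(1)[of "- R" S] q(3) by (simp add: v_def x_def)
  moreover have "F S x \<le> 1 / 2"
  proof -
    have "\<epsilon> * S = \<bar>R\<bar> + \<bar>K\<bar> + h" using eps by (simp add: S_def)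
    moreover have "d * S = D * S + 2 * (\<epsilon> * S)" by (simp add: \<epsilon>_def field_simps)
    ultimately have "x - C S \<ge> 0"
      using c(2)[of S] unfolding x_def C_def by linarith
    then have "k * (x - C S) \<ge> 0" using k by simp
    then have "exp (k * (x - C S)) \<ge> 1" by simp
    then show ?thesis by (simp add: F_def logistic_def field_simps add_pos_pos)
  qed
  ultimately show False
    using less[OF \<open>S \<ge> 0\<close>, of x] q(3) by simp
qed

lemma admissible_reflect:
  assumes "admissible a b"
  shows "admissible a (\<lambda>s. 1 - b s)"
  using assms unfolding admissible_def by (auto simp: periodic_fun_simple_def)

text \<open>The cubic changes sign when the states are exchanged and \<open>b\<close> becomes
  \<open>1 - b\<close>, as do the time derivative and the diffusion. The first space derivative
  keeps its sign, being reversed twice.\<close>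

lemma wave_speed_reflect:
  assumes "is_wave_speed a b T d"
  shows "is_wave_speed a (\<lambda>s. 1 - b s) T (- d)"
proof -
  obtain V where wave: "periodic_travelling_wave a b T d V"
    using assms by (auto simp: is_wave_speed_def)
  define v where "v = (\<lambda>t x. V t (x - d * t))"
  obtain p q r where
    p: "\<And>t x. ((\<lambda>s. v s x) has_real_derivative p t x) (at t)" and
    q: "\<And>t x. ((\<lambda>y. v t y) has_real_derivative q t x) (at x)" and
    r: "\<And>t x. ((\<lambda>y. q t y) has_real_derivative r t x) (at x)" and
    cont: "continuous_on UNIV (\<lambda>(t, x). p t x)" "continuous_on UNIV (\<lambda>(t, x). q t x)"
      "continuous_on UNIV (\<lambda>(t, x). r t x)" and
    eq: "\<And>t x. p t x = r t x + a (t / T) * v t x * (v t x - b (t / T)) * (1 - v t x)"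
    using wave unfolding periodic_travelling_wave_def bistable_solution_def v_def by blast
  define W where "W = (\<lambda>t x. 1 - V t (- x))"
  have reflect: "continuous_on UNIV (\<lambda>(t, x). g t (- x))"
    if "continuous_on UNIV (\<lambda>(t, x). g t x)" for g :: "real \<Rightarrow> real \<Rightarrow> real"
  proof -
    have "continuous_on UNIV (\<lambda>z :: real \<times> real. (\<lambda>(t, x). g t x) (fst z, - snd z))"
      by (rule continuous_on_compose2[OF that]) (auto intro!: continuous_intros)
    then show ?thesis by (simp add: split_beta')
  qed
  have mirror: "((\<lambda>y. g (- y)) has_real_derivative - l) (at x)"
    if "(g has_real_derivative l) (at (- x))" for g :: "real \<Rightarrow> real" and l x
    using that by (rule iffD1[OF DERIV_mirror])
  have "bistable_solution a (\<lambda>s. 1 - b s) T (\<lambda>t x. 1 - v t (- x))"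
    unfolding bistable_solution_def
  proof (intro exI conjI allI)
    show "((\<lambda>s. 1 - v s (- x)) has_real_derivative - p t (- x)) (at t)" for t x
      by (auto intro!: derivative_eq_intros p)
    show "((\<lambda>y. 1 - v t (- y)) has_real_derivative q t (- x)) (at x)" for t x
      using DERIV_diff[OF DERIV_const mirror[OF q], of 1 t x] by simp
    show "((\<lambda>y. q t (- y)) has_real_derivative - r t (- x)) (at x)" for t x
      by (rule mirror[OF r])
    show "continuous_on UNIV (\<lambda>(t, x). - p t (- x))" "continuous_on UNIV (\<lambda>(t, x). q t (- x))"
      "continuous_on UNIV (\<lambda>(t, x). - r t (- x))"
      using cont[THEN reflect] unfolding split_beta' by (auto intro!: continuous_intros)
    show "- p t (- x) = - r t (- x) + a (t / T) * (1 - v t (- x)) *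
        (1 - v t (- x) - (1 - b (t / T))) * (1 - (1 - v t (- x)))" for t x
      using eq[of t "- x"] by (simp add: algebra_simps)
  qed
  then have "bistable_solution a (\<lambda>s. 1 - b s) T (\<lambda>t x. W t (x - (- d) * t))"
    by (simp add: v_def W_def)
  moreover have "periodic_fun_simple W T"
    using wave by (simp add: periodic_travelling_wave_def periodic_fun_simple_def W_def)
  moreover have "uniform_limit UNIV (\<lambda>x t. W t x) (\<lambda>t. 1) at_bot"
    "uniform_limit UNIV (\<lambda>x t. W t x) (\<lambda>t. 0) at_top"
  proof -
    have lim: "uniform_limit UNIV (\<lambda>x t. V t x) (\<lambda>t. 1) at_bot"
      "uniform_limit UNIV (\<lambda>x t. V t x) (\<lambda>t. 0) at_top"
      using wave by (auto simp: periodic_travelling_wave_def)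
    have "uniform_limit UNIV (\<lambda>x t. 1 - V t (- x)) (\<lambda>t. 1 - 0) at_bot"
      using filterlim_compose[OF lim(2) filterlim_uminus_at_top_at_bot]
      by (intro uniform_limit_intros) auto
    then show "uniform_limit UNIV (\<lambda>x t. W t x) (\<lambda>t. 1) at_bot"
      by (simp add: W_def)
    have "uniform_limit UNIV (\<lambda>x t. 1 - V t (- x)) (\<lambda>t. 1 - 1) at_top"
      using filterlim_compose[OF lim(1) filterlim_uminus_at_bot_at_top]
      by (intro uniform_limit_intros) auto
    then show "uniform_limit UNIV (\<lambda>x t. W t x) (\<lambda>t. 0) at_top"
      by (simp add: W_def)
  qed
  ultimately show ?thesis
    unfolding is_wave_speed_def periodic_travelling_wave_def by blast
qed

text \<open>Reflection changes the sign of \<open>d\<close> and of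
  \<open>1 - 2 * integral {0..1} b\<close>, so the upper bound for the reflected wave is the missing
  lower bound.\<close>

lemma wave_speed_unique:
  assumes adm: "admissible (\<lambda>_. 2 * k\<^sup>2) b" and k: "k > 0" and T: "T > 0"
    and speed: "is_wave_speed (\<lambda>_. 2 * k\<^sup>2) b T d"
  shows "d = k * (1 - 2 * integral {0..1} b)"
proof (rule antisym)
  show "d \<le> k * (1 - 2 * integral {0..1} b)"
    by (rule wave_speed_upper_bound[OF assms])
  have "b integrable_on {0..1}"
    by (rule integrable_on_unit_interval[OF admissible_facts(2)[OF adm]])
  then have "integral {0..1} (\<lambda>s. 1 - b s) = 1 - integral {0..1} b"
    by (subst integral_diff) auto
  then have "- d \<le> k * (1 - 2 * (1 - integral {0..1} b))"
    using wave_speed_upper_bound[OF admissible_reflect[OF adm] k T wave_speed_reflect[OF speed]]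
    by simp
  then show "k * (1 - 2 * integral {0..1} b) \<le> d"
    by (simp add: algebra_simps)
qed

section \<open>Comparison of the speeds for constant threshold\<close>

text \<open>Cauchy-Schwarz in variance form: \<open>2 * integral {0..1} a - I\<^sup>2\<close> is the
  integral of the square of \<open>sqrt (2 * a s) - I\<close>, which is nonnegative and vanishes
  only for constant \<open>a\<close>.\<close>

lemma integral_sqrt_le:
  fixes a :: "real \<Rightarrow> real"
  assumes cont: "continuous_on UNIV a" and pos: "\<And>s. a s > 0" and per: "\<And>s. a (s + 1) = a s"
  defines "I \<equiv> integral {0..1} (\<lambda>s. sqrt (2 * a s))"
  shows "I > 0" and "I \<le> sqrt (2 * integral {0..1} a)"
    and "\<not> a constant_on UNIV \<Longrightarrow> I < sqrt (2 * integral {0..1} a)"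
proof -
  define \<sigma> where "\<sigma> = (\<lambda>s. sqrt (2 * a s))"
  have sq: "(\<sigma> s)\<^sup>2 = 2 * a s" and spos: "\<sigma> s > 0" for s
    using pos[of s] by (simp_all add: \<sigma>_def)
  have cs: "continuous_on UNIV \<sigma>"
    unfolding \<sigma>_def by (intro continuous_intros cont)
  have I: "I = integral {0..1} \<sigma>" by (simp add: I_def \<sigma>_def)
  have zero: "integral {0..1} f = 0 \<longleftrightarrow> (\<forall>s\<in>{0..1}. f s = 0)"
    if "continuous_on UNIV f" "\<And>s. f s \<ge> 0" for f :: "real \<Rightarrow> real"
    using that by (intro integral_eq_0_iff continuous_on_subset[OF that(1)]) auto
  have "I \<noteq> 0"
    using zero[OF cs] spos unfolding I by (metis atLeastAtMost_iff less_eq_real_def less_irrefl zero_le_one)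
  moreover have "I \<ge> 0"
    unfolding I using spos by (intro integral_nonneg integrable_on_unit_interval cs) (auto simp: less_imp_le)
  ultimately show "I > 0" by simp
  define w where "w = (\<lambda>s. (\<sigma> s - I)\<^sup>2)"
  have cw: "continuous_on UNIV w"
    unfolding w_def by (intro continuous_intros cs)
  have "w = (\<lambda>s. 2 * a s - 2 * I * \<sigma> s + I\<^sup>2)"
    using sq by (simp add: w_def power2_diff algebra_simps fun_eq_iff)
  then have "(w has_integral 2 * integral {0..1} a - 2 * I * integral {0..1} \<sigma> + I\<^sup>2) {0..1}"
    using has_integral_const_real[of "I\<^sup>2" 0 1]
    by (auto intro!: has_integral_add has_integral_diff has_integral_mult_right integrable_integral
        integrable_on_unit_interval cont cs)
  then have w: "integral {0..1} w = 2 * integral {0..1} a - I\<^sup>2"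
    by (simp add: integral_unique I power2_eq_square)
  have "integral {0..1} w \<ge> 0"
    by (intro integral_nonneg integrable_on_unit_interval cw) (simp add: w_def)
  then have "I\<^sup>2 \<le> 2 * integral {0..1} a" using w by simp
  then show "I \<le> sqrt (2 * integral {0..1} a)" by (rule real_le_rsqrt)
  assume nonconst: "\<not> a constant_on UNIV"
  have "integral {0..1} w \<noteq> 0"
  proof
    assume "integral {0..1} w = 0"
    then have "\<forall>s\<in>{0..1}. w s = 0"
      using zero[OF cw] by (simp add: w_def)
    \<comment> \<open>Zero variance determines \<open>a\<close> on one period only; periodicity
      extends this to the line.\<close>
    then have unit: "a s = I\<^sup>2 / 2" if "s \<in> {0..1}" for s
      using that sq[of s] by (simp add: w_def)
    have "\<forall>s. a s = I\<^sup>2 / 2"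
      using periodic_representative[of 1] periodic_shift_int[of a 1, OF per] unit
      by (metis zero_less_one)
    with nonconst show False unfolding constant_on_def by blast
  qed
  with \<open>integral {0..1} w \<ge> 0\<close> w have "I\<^sup>2 < 2 * integral {0..1} a" by simp
  then show "I < sqrt (2 * integral {0..1} a)" by (rule real_less_rsqrt)
qed

text \<open>The common factor \<open>1 / 2 - b0\<close> decides which way the inequality of
  \<open>integral_sqrt_le\<close> carries over to the speeds.\<close>

lemma speeds_const_threshold:
  assumes adm: "admissible a (\<lambda>_. b0)"
  shows "speed0 a (\<lambda>_. b0) = sqrt (2 * integral {0..1} a) * (1 / 2 - b0)"
    and "speed_star a (\<lambda>_. b0) = integral {0..1} (\<lambda>s. sqrt (2 * a s)) * (1 / 2 - b0)"
proof -
  note a = admissible_facts[OF adm]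
  note I = integral_sqrt_le[OF a(1,5,3)]
  have "sqrt (2 * integral {0..1} a) > 0" using I(1,2) by linarith
  then have "integral {0..1} a \<noteq> 0" by auto
  then show "speed0 a (\<lambda>_. b0) = sqrt (2 * integral {0..1} a) * (1 / 2 - b0)"
    by (simp add: speed0_def)
  show "speed_star a (\<lambda>_. b0) = integral {0..1} (\<lambda>s. sqrt (2 * a s)) * (1 / 2 - b0)"
    unfolding speed_star_def by (rule integral_mult_left)
qed

section \<open>An example with speeds of opposite sign\<close>

lemma C1_differentiable_on_of_derivative:
  fixes f f' :: "real \<Rightarrow> real"
  assumes "\<And>s. (f has_real_derivative f' s) (at s)" "continuous_on UNIV f'"
  shows "f C1_differentiable_on UNIV"
  using assms unfolding C1_differentiable_on_def has_real_derivative_iff_has_vector_derivative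
  by blast

text \<open>With \<open>\<sigma> = sqrt (2 a)\<close> and \<open>\<beta> = 1/2 - b\<close>, the sign of \<open>d\<^sub>0\<close> is that of the mean of
  \<open>\<sigma>\<^sup>2 \<beta>\<close>, while \<open>d\<^sub>*\<close> is the mean of \<open>\<sigma> \<beta>\<close>. Take \<open>\<sigma> = 2 + cos\<close> and \<open>\<beta>\<close> proportional to
  \<open>cos - \<delta>\<close>: the signs differ whenever \<open>1/4 < \<delta> < 4/9\<close>.\<close>

lemma opposite_speeds_exist:
  "\<exists>a b. admissible a b \<and> speed_star a b < 0 \<and> 0 < speed0 a b"
proof -
  define C S :: "real \<Rightarrow> real" where "C = (\<lambda>s. cos (2 * pi * s))" and "S = (\<lambda>s. sin (2 * pi * s))"
  \<comment> \<open>Here \<delta> = 1/3, and the factor 1/4 keeps \<open>b\<close> between 1/3 and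
    5/6.\<close>
  define a b :: "real \<Rightarrow> real" where "a = (\<lambda>s. (2 + C s)\<^sup>2 / 2)" and "b = (\<lambda>s. 1 / 2 - (C s - 1 / 3) / 4)"
  have dC: "(C has_real_derivative - (2 * pi * S s)) (at s)"
    and dS: "(S has_real_derivative 2 * pi * C s) (at s)" for s
    unfolding C_def S_def by (auto intro!: derivative_eq_intros)
  have C: "-1 \<le> C s" "C s \<le> 1" for s by (simp_all add: C_def)
  have SS: "(S s)\<^sup>2 = 1 - (C s)\<^sup>2" for s by (simp add: C_def S_def sin_squared_eq)
  have per: "C (s + 1) = C s" for s by (simp add: C_def distrib_left)
  have cont: "continuous_on A C" "continuous_on A S" for A
    unfolding C_def S_def by (intro continuous_intros)+
  have "admissible a b"
    unfolding admissible_def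
  proof (intro conjI allI)
    have "(a has_real_derivative (2 + C s) * (- (2 * pi * S s))) (at s)" for s
      unfolding a_def by (auto intro!: derivative_eq_intros dC)
    moreover have "continuous_on UNIV (\<lambda>s. (2 + C s) * (- (2 * pi * S s)))"
      by (intro continuous_intros cont)
    ultimately show "a C1_differentiable_on UNIV"
      by (rule C1_differentiable_on_of_derivative)
    have "(b has_real_derivative 2 * pi * S s / 4) (at s)" for s
      unfolding b_def by (auto intro!: derivative_eq_intros dC)
    moreover have "continuous_on UNIV (\<lambda>s. 2 * pi * S s / 4)"
      by (intro continuous_intros cont) auto
    ultimately show "b C1_differentiable_on UNIV"
      by (rule C1_differentiable_on_of_derivative)
    show "periodic_fun_simple a 1" "periodic_fun_simple b 1"
      by (simp_all add: periodic_fun_simple_def a_def b_def per)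
    show "0 < a s" for s using C(1)[of s] by (simp add: a_def)
    show "0 < b s" "b s < 1" for s using C[of s] by (simp_all add: b_def less_divide_eq divide_less_eq field_simps)
  qed
  have C1: "(C has_integral 0) {0..1}"
  proof -
    have "((\<lambda>s. S s / (2 * pi)) has_real_derivative C s) (at s within {0..1})" for s
      by (rule DERIV_subset[of _ _ _ UNIV]) (auto intro!: derivative_eq_intros dS)
    then have "(C has_integral S 1 / (2 * pi) - S 0 / (2 * pi)) {0..1}"
      by (intro fundamental_theorem_of_calculus)
        (auto simp flip: has_real_derivative_iff_has_vector_derivative)
    then show ?thesis by (simp add: S_def)
  qed
  have C2: "((\<lambda>s. (C s)\<^sup>2) has_integral 1 / 2) {0..1}"
  proof -
    have "((\<lambda>s. s / 2 + S s * C s / (4 * pi)) has_real_derivative (C s)\<^sup>2) (at s within {0..1})" for s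
    proof (rule DERIV_subset[of _ _ _ UNIV])
      have "((\<lambda>s. S s * C s) has_real_derivative 2 * pi * C s * C s - 2 * pi * (S s)\<^sup>2) (at s)"
        by (auto intro!: derivative_eq_intros dS dC simp: power2_eq_square)
      then have "((\<lambda>s. s / 2 + S s * C s / (4 * pi)) has_real_derivative
          1 / 2 + (2 * pi * C s * C s - 2 * pi * (S s)\<^sup>2) / (4 * pi)) (at s)"
        by (intro DERIV_add DERIV_cdivide DERIV_ident)
      moreover have "1 / 2 + (2 * pi * C s * C s - 2 * pi * (S s)\<^sup>2) / (4 * pi) = (C s)\<^sup>2"
        unfolding SS by (simp add: field_simps power2_eq_square)
      ultimately show "((\<lambda>s. s / 2 + S s * C s / (4 * pi)) has_real_derivative (C s)\<^sup>2) (at s)"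
        by simp
    qed simp
    then have "((\<lambda>s. (C s)\<^sup>2) has_integral
        (1 / 2 + S 1 * C 1 / (4 * pi)) - (0 / 2 + S 0 * C 0 / (4 * pi))) {0..1}"
      by (intro fundamental_theorem_of_calculus)
        (auto simp flip: has_real_derivative_iff_has_vector_derivative)
    then show ?thesis by (simp add: S_def)
  qed
  have C3: "((\<lambda>s. C s ^ 3) has_integral 0) {0..1}"
  proof -
    \<comment> \<open>The antiderivative comes from writing the cubed cosine as
      \<open>C s * (1 - (S s)\<^sup>2)\<close>.\<close>
    have "((\<lambda>s. (S s - S s ^ 3 / 3) / (2 * pi)) has_real_derivative C s ^ 3) (at s within {0..1})" for s
    proof (rule DERIV_subset[of _ _ _ UNIV])
      have "((\<lambda>s. S s - S s ^ 3 / 3) has_real_derivative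
          2 * pi * C s - (S s)\<^sup>2 * (2 * pi * C s)) (at s)"
        by (auto intro!: derivative_eq_intros dS simp: power2_eq_square)
      then have "((\<lambda>s. (S s - S s ^ 3 / 3) / (2 * pi)) has_real_derivative
          (2 * pi * C s - (S s)\<^sup>2 * (2 * pi * C s)) / (2 * pi)) (at s)"
        by (rule DERIV_cdivide)
      moreover have "(2 * pi * C s - (S s)\<^sup>2 * (2 * pi * C s)) / (2 * pi) = C s ^ 3"
        unfolding SS by (simp add: field_simps power2_eq_square power3_eq_cube)
      ultimately show "((\<lambda>s. (S s - S s ^ 3 / 3) / (2 * pi)) has_real_derivative C s ^ 3) (at s)"
        by simp
    qed simp
    then have "((\<lambda>s. C s ^ 3) has_integral
        (S 1 - S 1 ^ 3 / 3) / (2 * pi) - (S 0 - S 0 ^ 3 / 3) / (2 * pi)) {0..1}"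
      by (intro fundamental_theorem_of_calculus)
        (auto simp flip: has_real_derivative_iff_has_vector_derivative)
    then show ?thesis by (simp add: S_def)
  qed
  \<comment> \<open>The first and third powers of the cosine have mean 0 and the square has mean
    1/2. The integrands below are expanded into this form, with a zero cubic coefficient where
    needed.\<close>
  have cubic: "((\<lambda>s. k0 + k1 * C s + k2 * (C s)\<^sup>2 + k3 * C s ^ 3) has_integral k0 + k2 / 2) {0..1}"
    for k0 k1 k2 k3
  proof -
    have "((\<lambda>s. k0 + k1 * C s + k2 * (C s)\<^sup>2 + k3 * C s ^ 3) has_integral
        (k0 + k1 * 0 + k2 * (1 / 2) + k3 * 0)) {0..1}"
      using has_integral_const_real[of k0 0 1]
      by (intro has_integral_add has_integral_mult_right C1 C2 C3) simp
    then show ?thesis by simp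
  qed
  have "sqrt (2 * a s) = 2 + C s" for s
    using C(1)[of s] by (simp add: a_def)
  then have "(\<lambda>s. sqrt (2 * a s) * (1 / 2 - b s))
      = (\<lambda>s. - 1 / 6 + 5 / 12 * C s + 1 / 4 * (C s)\<^sup>2 + 0 * C s ^ 3)"
    by (simp add: b_def fun_eq_iff field_simps power2_eq_square)
  then have "speed_star a b = - 1 / 24"
    using integral_unique[OF cubic[of "- 1 / 6" "5 / 12" "1 / 4" 0]] by (simp add: speed_star_def)
  moreover have "integral {0..1} a = 9 / 4"
  proof -
    have "a = (\<lambda>s. 2 + 2 * C s + 1 / 2 * (C s)\<^sup>2 + 0 * C s ^ 3)"
      by (simp add: a_def fun_eq_iff field_simps power2_eq_square)
    then show ?thesis using integral_unique[OF cubic[of 2 2 "1 / 2" 0]] by simp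
  qed
  moreover have "integral {0..1} (\<lambda>s. a s * b s) = 17 / 16"
  proof -
    have "(\<lambda>s. a s * b s) = (\<lambda>s. 7 / 6 + 2 / 3 * C s + - 5 / 24 * (C s)\<^sup>2 + - 1 / 8 * C s ^ 3)"
      by (simp add: a_def b_def fun_eq_iff field_simps power2_eq_square power3_eq_cube)
    then show ?thesis
      using integral_unique[OF cubic[of "7 / 6" "2 / 3" "- 5 / 24" "- 1 / 8"]] by simp
  qed
  \<comment> \<open>The bracket in \<open>speed0\<close> equals 1/2 - 17/36 = 1/36.\<close>
  ultimately have "speed_star a b < 0" "0 < speed0 a b"
    by (simp_all add: speed0_def)
  with \<open>admissible a b\<close> show ?thesis by blast
qed

theorem proposition1p11:
  shows
    "(\<forall>a b a0. admissible a b \<and> (\<forall>s. a s = a0) \<longrightarrow>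
        (\<forall>T>0. (\<exists>!d. is_wave_speed a b T d) \<and>
          wave_speed a b T = speed0 a b \<and> speed0 a b = speed_star a b))
   \<and> (\<forall>a b b0. admissible a b \<and> (\<forall>s. b s = b0) \<longrightarrow>
        (0 < b0 \<and> b0 < 1 / 2 \<longrightarrow>
           speed0 a b \<ge> speed_star a b \<and> speed_star a b > 0 \<and>
           (\<not> a constant_on UNIV \<longrightarrow> speed0 a b > speed_star a b)) \<and>
        (1 / 2 < b0 \<and> b0 < 1 \<longrightarrow>
           speed0 a b \<le> speed_star a b \<and> speed_star a b < 0 \<and>
           (\<not> a constant_on UNIV \<longrightarrow> speed0 a b < speed_star a b)))
   \<and> (\<exists>a b. admissible a b \<and>
        (speed0 a b < 0 \<and> 0 < speed_star a b \<or> speed_star a b < 0 \<and> 0 < speed0 a b))"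
proof (intro conjI)
  show "\<forall>a b a0. admissible a b \<and> (\<forall>s. a s = a0) \<longrightarrow>
        (\<forall>T>0. (\<exists>!d. is_wave_speed a b T d) \<and>
          wave_speed a b T = speed0 a b \<and> speed0 a b = speed_star a b)"
  proof (intro allI impI, elim conjE)
    fix a b :: "real \<Rightarrow> real" and a0 T :: real
    assume adm: "admissible a b" and const: "\<forall>s. a s = a0" and T: "T > 0"
    define k where "k = sqrt (a0 / 2)"
    have "a0 > 0" using admissible_facts(5)[OF adm, of 0] const by simp
    then have k: "k > 0" and a: "a = (\<lambda>_. 2 * k\<^sup>2)"
      using const by (auto simp: k_def)
    define D where "D = k * (1 - 2 * integral {0..1} b)"
    \<comment> \<open>The equivalence yields existence, uniqueness and the value of the definite
      description at once.\<close>
    have iff: "is_wave_speed a b T d \<longleftrightarrow> d = D" for d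
      using wave_speed_exists[OF adm[unfolded a] k T] wave_speed_unique[OF adm[unfolded a] k T]
      unfolding D_def a by blast
    show "(\<exists>!d. is_wave_speed a b T d) \<and>
        wave_speed a b T = speed0 a b \<and> speed0 a b = speed_star a b"
      using speed_star_const[OF adm[unfolded a] k]
      unfolding wave_speed_def iff by (simp add: a D_def)
  qed
  show "\<forall>a b b0. admissible a b \<and> (\<forall>s. b s = b0) \<longrightarrow>
        (0 < b0 \<and> b0 < 1 / 2 \<longrightarrow>
           speed0 a b \<ge> speed_star a b \<and> speed_star a b > 0 \<and>
           (\<not> a constant_on UNIV \<longrightarrow> speed0 a b > speed_star a b)) \<and>
        (1 / 2 < b0 \<and> b0 < 1 \<longrightarrow>
           speed0 a b \<le> speed_star a b \<and> speed_star a b < 0 \<and>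
           (\<not> a constant_on UNIV \<longrightarrow> speed0 a b < speed_star a b))"
  proof (intro allI impI, elim conjE)
    fix a b :: "real \<Rightarrow> real" and b0 :: real
    assume adm: "admissible a b" and const: "\<forall>s. b s = b0"
    have b: "b = (\<lambda>_. b0)" using const by auto
    note I = integral_sqrt_le[OF admissible_facts(1,5,3)[OF adm]]
    note speeds = speeds_const_threshold[OF adm[unfolded b], folded b]
    show "(0 < b0 \<and> b0 < 1 / 2 \<longrightarrow>
           speed0 a b \<ge> speed_star a b \<and> speed_star a b > 0 \<and>
           (\<not> a constant_on UNIV \<longrightarrow> speed0 a b > speed_star a b)) \<and>
        (1 / 2 < b0 \<and> b0 < 1 \<longrightarrow>
           speed0 a b \<le> speed_star a b \<and> speed_star a b < 0 \<and>
           (\<not> a constant_on UNIV \<longrightarrow> speed0 a b < speed_star a b))"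
      unfolding speeds using I
      by (auto intro: mult_right_mono mult_strict_right_mono mult_right_mono_neg
          mult_strict_right_mono_neg mult_pos_pos mult_pos_neg)
  qed
  show "\<exists>a b. admissible a b \<and>
        (speed0 a b < 0 \<and> 0 < speed_star a b \<or> speed_star a b < 0 \<and> 0 < speed0 a b)"
    using opposite_speeds_exist by blast
qed

end
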